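(* Let $S\subseteq X$ be star shaped at $x_0\in S$ and let $F:S\to Y$ be radially $C$-continuous with respect to $x_0$, i.e. for all $x\in S$, $$\forall U\in\mathcal U_Y(0)\ \exists t_U\in(0,1)\ \forall t\in(0,t_U):\quad F(x_0+t(x-x_0))\in F(x_0)+C+U.$$ Assume that for all $w^*\in W^*$ the function $w^*\circ F:X\to\overline{\mathbb R}$ is either both radially pseudoconvex and radially pseudoconcave with respect to $x_0$, or radially convex with respect to $x_0$. If $$\forall x\in X\ \exists w^*\in W^*:\quad (w^*\circ F)^{\downarrow}(x,x_0-x)\le 0,$$ then $(F(x_0)-\operatorname{int}C)\cap\{F(x): x\in S\}=\emptyset$, i.e. $x_0$ is a weakly efficient minimizer of $F$.
   Context: Setting: $X,Y$ are real locally convex Hausdorff spaces; $\mathcal U_Y(0)$ is a $0$-neighborhood base of $Y$ consisting of balanced convex open sets. $Y$ is pre-ordered by a closed convex cone $C\subseteq Y$ with $\operatorname{int}C\ne\emptyset$ and $C\ne Y$. $C^+=\{y^*\in Y^*: y^*(c)\ge 0\ \forall c\in C\}$, and $W^*$ is a fixed weak$^*$-compact base of $C^+$ (it exists because $\operatorname{int}C\neq\emptyset$). $\overline{\mathbb R}=\mathbb R\cup\{\pm\infty\}$, with $\inf\emptyset=+\infty$ and $(\pm\infty)+r=\pm\infty$ for $r\in\mathbb R$. $S$ is star shaped at $x_0\in S$ if $x\in S$ implies $x_0+t(x-x_0)\in S$ for all $t\in[0,1]$. The function $w^*\circ F$ is extended to $X$ by the value $+\infty$ outside $S$. For $\varphi$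 with values in $\overline{\mathbb R}$, $\operatorname{dom}\varphi=\{x:\varphi(x)\ne+\infty\}$. Lower Dini derivative: $\varphi^{\downarrow}(x,u)=\liminf_{t\downarrow0}\frac1t\inf\{\rho\in\mathbb R:\varphi(x+tu)\le\varphi(x)+\rho\}$. $\varphi$ is pseudoconvex if for all $a,b\in\operatorname{dom}\varphi$, $\varphi(a)<\varphi(b)$ implies $\varphi^\downarrow(b,a-b)<0$; it is pseudoconcave if for all $a,b\in\operatorname{dom}\varphi$, $\varphi(a)>\varphi(b)$ implies $\varphi^\downarrow(b,a-b)>0$. For $\varphi:X\to\overline{\mathbb R}$ and $x\in X$, $\varphi_{x_0,x}:\mathbb R\to\overline{\mathbb R}$ is $\varphi_{x_0,x}(t)=\varphi(x_0+t(x-x_0))$ for $0\le t\le1$ and $+\infty$ elsewhere. $\varphi$ is radially pseudoconvex (pseudoconcave, convex) w.r.t. $x_0$ if $\varphi_{x_0,x}$ is pseudoconvex (pseudoconcave, convex) for all $x\in X$. *)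

theory Defs
  imports "HOL-Analysis.Analysis"
begin

text \<open>
  Real locally convex Hausdorff topological vector spaces. The last assumption spells out
  \<open>convex U\<close>, which cannot be used in a class specification.
\<close>

class locally_convex_t2_space = real_vector + topological_ab_group_add + t2_space +
  assumes tendsto_scaleR_Pair:
    "LIM p (nhds r \<times>\<^sub>F nhds a). fst p *\<^sub>R snd p :> nhds (r *\<^sub>R a)"
  assumes locally_convex:
    "\<lbrakk>open V; 0 \<in> V\<rbrakk> \<Longrightarrow> \<exists>U. open U \<and> 0 \<in> U \<and> U \<subseteq> V \<and>
      (\<forall>x\<in>U. \<forall>y\<in>U. \<forall>u\<ge>0. \<forall>v\<ge>0. u + v = 1 \<longrightarrow> u *\<^sub>R x + v *\<^sub>R y \<in> U)"

definition balanced :: "'a::real_vector set \<Rightarrow> bool"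
  where "balanced U \<longleftrightarrow> (\<forall>t u. \<bar>t\<bar> \<le> 1 \<longrightarrow> u \<in> U \<longrightarrow> t *\<^sub>R u \<in> U)"

definition bco_zero_nbhd_base :: "'a::{real_vector, topological_space} set set \<Rightarrow> bool"
  where "bco_zero_nbhd_base \<U> \<longleftrightarrow>
    (\<forall>U\<in>\<U>. balanced U \<and> convex U \<and> open U \<and> 0 \<in> U) \<and>
    (\<forall>V. open V \<longrightarrow> 0 \<in> V \<longrightarrow> (\<exists>U\<in>\<U>. U \<subseteq> V))"

definition top_dual :: "('a::{real_vector, topological_space} \<Rightarrow> real) set"
  where "top_dual = {f. linear f \<and> continuous_on UNIV f}"

text \<open>The weak* topology is the topology of pointwise convergence on the dual.\<close>

definition weak_star_topology :: "('a::{real_vector, topological_space} \<Rightarrow> real) topology"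
  where "weak_star_topology =
    subtopology (product_topology (\<lambda>_. euclideanreal) UNIV) top_dual"

definition dual_cone :: "'a::{real_vector, topological_space} set \<Rightarrow> ('a \<Rightarrow> real) set"
  where "dual_cone C = {f \<in> top_dual. \<forall>c\<in>C. 0 \<le> f c}"

text \<open>
  A base of a cone \<open>K\<close> of functionals is a convex set \<open>B\<close> that generates \<open>K\<close> and does not
  have \<open>0\<close> in its closure. Weak*-compact sets are weak*-closed, so \<open>0 \<notin> B\<close> suffices here.
  Vector operations on functionals are written pointwise because the function type
  carries no \<open>real_vector\<close> structure.
\<close>

definition weak_star_compact_base :: 
    "('a::{real_vector, topological_space} \<Rightarrow> real) set \<Rightarrow> ('a \<Rightarrow> real) set \<Rightarrow> bool"
  where "weak_star_compact_base K B \<longleftrightarrow>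
    compactin weak_star_topology B \<and>
    (\<forall>f\<in>B. \<forall>g\<in>B. \<forall>t\<in>{0..1}. (\<lambda>y. (1 - t) * f y + t * g y) \<in> B) \<and>
    (\<lambda>y. 0) \<notin> B \<and>
    K = {(\<lambda>y. t * f y) | t f. 0 \<le> t \<and> f \<in> B}"

definition star_shaped_at :: "'a::real_vector set \<Rightarrow> 'a \<Rightarrow> bool"
  where "star_shaped_at S x0 \<longleftrightarrow>
    x0 \<in> S \<and> (\<forall>x\<in>S. \<forall>t\<in>{0..1}. x0 + t *\<^sub>R (x - x0) \<in> S)"

text \<open>
  A map \<open>F : S \<rightarrow> Y\<close> is represented by a total function of which only the values on \<open>S\<close>
  are used; \<open>scalarization S F w\<close> is \<open>w \<circ> F\<close> extended by \<open>\<infinity>\<close> outside \<open>S\<close>.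
\<close>

definition scalarization :: "'a set \<Rightarrow> ('a \<Rightarrow> 'b) \<Rightarrow> ('b \<Rightarrow> real) \<Rightarrow> 'a \<Rightarrow> ereal"
  where "scalarization S F w x = (if x \<in> S then ereal (w (F x)) else \<infinity>)"

definition effective_dom :: "('a \<Rightarrow> ereal) \<Rightarrow> 'a set"
  where "effective_dom \<phi> = {x. \<phi> x \<noteq> \<infinity>}"

definition lower_dini :: "('a::real_vector \<Rightarrow> ereal) \<Rightarrow> 'a \<Rightarrow> 'a \<Rightarrow> ereal"
  where "lower_dini \<phi> x u =
    Liminf (at_right 0)
      (\<lambda>t. ereal (1 / t) * (INF \<rho>\<in>{\<rho>::real. \<phi> (x + t *\<^sub>R u) \<le> \<phi> x + ereal \<rho>}. ereal \<rho>))"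

definition pseudoconvex :: "('a::real_vector \<Rightarrow> ereal) \<Rightarrow> bool"
  where "pseudoconvex \<phi> \<longleftrightarrow>
    (\<forall>a\<in>effective_dom \<phi>. \<forall>b\<in>effective_dom \<phi>. \<phi> a < \<phi> b \<longrightarrow> lower_dini \<phi> b (a - b) < 0)"

definition pseudoconcave :: "('a::real_vector \<Rightarrow> ereal) \<Rightarrow> bool"
  where "pseudoconcave \<phi> \<longleftrightarrow>
    (\<forall>a\<in>effective_dom \<phi>. \<forall>b\<in>effective_dom \<phi>. \<phi> a > \<phi> b \<longrightarrow> lower_dini \<phi> b (a - b) > 0)"

definition ereal_convex :: "('a::real_vector \<Rightarrow> ereal) \<Rightarrow> bool"
  where "ereal_convex \<phi> \<longleftrightarrow> convex {(x, r::real). \<phi> x \<le> ereal r}"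

definition radial_restriction :: "('a::real_vector \<Rightarrow> ereal) \<Rightarrow> 'a \<Rightarrow> 'a \<Rightarrow> real \<Rightarrow> ereal"
  where "radial_restriction \<phi> x0 x t =
    (if 0 \<le> t \<and> t \<le> 1 then \<phi> (x0 + t *\<^sub>R (x - x0)) else \<infinity>)"

definition radially_pseudoconvex :: "('a::real_vector \<Rightarrow> ereal) \<Rightarrow> 'a \<Rightarrow> bool"
  where "radially_pseudoconvex \<phi> x0 \<longleftrightarrow> (\<forall>x. pseudoconvex (radial_restriction \<phi> x0 x))"

definition radially_pseudoconcave :: "('a::real_vector \<Rightarrow> ereal) \<Rightarrow> 'a \<Rightarrow> bool"
  where "radially_pseudoconcave \<phi> x0 \<longleftrightarrow> (\<forall>x. pseudoconcave (radial_restriction \<phi> x0 x))"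

definition radially_convex :: "('a::real_vector \<Rightarrow> ereal) \<Rightarrow> 'a \<Rightarrow> bool"
  where "radially_convex \<phi> x0 \<longleftrightarrow> (\<forall>x. ereal_convex (radial_restriction \<phi> x0 x))"

text \<open>\<open>\<U>\<close> plays the role of the fixed \<open>0\<close>-neighborhood base of the target space.\<close>

definition radially_C_continuous ::
    "'b::real_vector set set \<Rightarrow> 'b set \<Rightarrow> 'a::real_vector set \<Rightarrow> ('a \<Rightarrow> 'b) \<Rightarrow> 'a \<Rightarrow> bool"
  where "radially_C_continuous \<U> C S F x0 \<longleftrightarrow>
    (\<forall>x\<in>S. \<forall>U\<in>\<U>. \<exists>tU\<in>{0<..<1}. \<forall>t\<in>{0<..<tU}.
      F (x0 + t *\<^sub>R (x - x0)) \<in> {F x0 + c + u | c u. c \<in> C \<and> u \<in> U})"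

definition weakly_efficient_minimizer ::
    "'b::{real_vector, topological_space} set \<Rightarrow> 'a set \<Rightarrow> ('a \<Rightarrow> 'b) \<Rightarrow> 'a \<Rightarrow> bool"
  where "weakly_efficient_minimizer C S F x0 \<longleftrightarrow>
    {F x0 - c | c. c \<in> interior C} \<inter> F ` S = {}"

end

theory Submission
  imports Defs
begin

text \<open>
  Suppose that \<open>F x = F x0 - c\<close> with \<open>c \<in> int C\<close>. A nonzero functional in the dual cone is
  strictly positive on \<open>int C\<close> (\<open>dual_cone_pos_on_interior\<close>), so every \<open>w \<in> W\<close> satisfies
  \<open>w (F x) < w (F x0)\<close>. Moreover, if \<open>U\<close> is a neighborhood of \<open>0\<close> with \<open>c + U \<subseteq> int C\<close>, radial
  \<open>C\<close>-continuity gives \<open>F (x0 + t (x - x0)) \<in> F x0 + C + U = F x + C + (c + U)\<close> for all small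
  \<open>t\<close>. Hence \<open>w (F x) < w (F (x0 + t (x - x0)))\<close> for all small \<open>t\<close>, where the bound on \<open>t\<close> does
  not depend on \<open>w\<close>. This uniformity is the heart of the proof: one may fix a single \<open>t\<close> first
  and only then take the functional \<open>w\<close> that the Dini derivative hypothesis provides at the
  point \<open>x0 + t (x - x0)\<close>.

  What remains concerns the single function \<open>g s = w (F (x0 + s (x - x0)))\<close> on \<open>[0,1]\<close>, for
  which \<open>g 1 < g s\<close> whenever \<open>0 \<le> s \<le> t\<close>; the claim is that the lower Dini derivative of \<open>g\<close> at
  \<open>t\<close> towards \<open>0\<close> is positive. If \<open>g\<close> is convex, it increases from \<open>t\<close> towards \<open>0\<close> at least with
  the slope that it has between \<open>1\<close> and \<open>t\<close> (\<open>convex_lower_dini_pos\<close>). If \<open>g\<close> is pseudoconvex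
  and pseudoconcave, seen from any point \<open>b\<close> it cannot take both a larger and a smaller value
  than \<open>g b\<close> in the same direction, because the sign of the Dini derivative at \<open>b\<close> depends only
  on the direction (\<open>pseudolinear_ray_values\<close>). This forces \<open>g t < g 0\<close>, and then
  pseudoconcavity applies at \<open>t\<close> (\<open>pseudolinear_lower_dini_pos\<close>).
\<close>

section \<open>Signs of lower Dini derivatives\<close>

lemma lower_dini_ge:
  assumes r: "\<phi> x = ereal r" and "e > 0"
    and growth: "\<And>t. 0 < t \<Longrightarrow> t < e \<Longrightarrow> ereal (r + t * m) \<le> \<phi> (x + t *\<^sub>R u)"
  shows "ereal m \<le> lower_dini \<phi> x u"
  unfolding lower_dini_def
proof (rule Liminf_bounded)
  have "\<forall>\<^sub>F t in at_right 0. t \<in> {0<..<e}"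
    using \<open>e > 0\<close> by (rule eventually_at_right_real)
  then show "\<forall>\<^sub>F t in at_right 0. ereal m \<le> ereal (1 / t) *
      (INF \<rho>\<in>{\<rho>::real. \<phi> (x + t *\<^sub>R u) \<le> \<phi> x + ereal \<rho>}. ereal \<rho>)"
  proof eventually_elim
    case (elim t)
    then have t: "0 < t" "t < e" by auto
    let ?I = "INF \<rho>\<in>{\<rho>::real. \<phi> (x + t *\<^sub>R u) \<le> \<phi> x + ereal \<rho>}. ereal \<rho>"
    have "ereal (t * m) \<le> ?I"
    proof (rule INF_greatest)
      fix \<rho> assume "\<rho> \<in> {\<rho>::real. \<phi> (x + t *\<^sub>R u) \<le> \<phi> x + ereal \<rho>}"
      then have "\<phi> (x + t *\<^sub>R u) \<le> ereal (r + \<rho>)" by (simp add: r)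
      with growth[OF t] have "ereal (r + t * m) \<le> ereal (r + \<rho>)" by (rule order_trans)
      then show "ereal (t * m) \<le> ereal \<rho>" by simp
    qed
    then have "ereal (1 / t) * ereal (t * m) \<le> ereal (1 / t) * ?I"
      using t by (intro ereal_mult_left_mono) auto
    then show ?case using t by simp
  qed
qed

lemma lower_dini_neg_imp_descent:
  assumes "lower_dini \<phi> x u < 0" and "\<bar>\<phi> x\<bar> \<noteq> \<infinity>" and "e > 0"
  obtains t where "0 < t" "t < e" "\<phi> (x + t *\<^sub>R u) < \<phi> x"
proof (rule ccontr)
  assume "\<not> thesis"
  with that have ge: "\<And>t. 0 < t \<Longrightarrow> t < e \<Longrightarrow> \<phi> x \<le> \<phi> (x + t *\<^sub>R u)"
    by (meson not_le)
  obtain r where "\<phi> x = ereal r" using assms(2) by (cases "\<phi> x") auto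
  then have "ereal 0 \<le> lower_dini \<phi> x u"
    using ge by (intro lower_dini_ge[OF _ \<open>e > 0\<close>]) auto
  with assms(1) show False by (simp add: zero_ereal_def)
qed

lemma lower_dini_pos_imp_ascent:
  assumes "lower_dini \<phi> x u > 0"
  obtains e where "e > 0" "\<And>t. 0 < t \<Longrightarrow> t < e \<Longrightarrow> \<phi> x < \<phi> (x + t *\<^sub>R u)"
proof -
  have "\<forall>\<^sub>F t in at_right 0. 0 < ereal (1 / t) *
      (INF \<rho>\<in>{\<rho>::real. \<phi> (x + t *\<^sub>R u) \<le> \<phi> x + ereal \<rho>}. ereal \<rho>)"
    using assms unfolding lower_dini_def by (rule less_LiminfD)
  then obtain e where e: "e > 0" and pos: "\<And>t. 0 < t \<Longrightarrow> t < e \<Longrightarrow> 0 < ereal (1 / t) *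
      (INF \<rho>\<in>{\<rho>::real. \<phi> (x + t *\<^sub>R u) \<le> \<phi> x + ereal \<rho>}. ereal \<rho>)"
    unfolding eventually_at_right_field by auto
  have "\<phi> x < \<phi> (x + t *\<^sub>R u)" if t: "0 < t" "t < e" for t
  proof (rule ccontr)
    \<comment> \<open>Without ascent, \<open>\<rho> = 0\<close> is admissible in the infimum.\<close>
    assume "\<not> \<phi> x < \<phi> (x + t *\<^sub>R u)"
    then have "(INF \<rho>\<in>{\<rho>::real. \<phi> (x + t *\<^sub>R u) \<le> \<phi> x + ereal \<rho>}. ereal \<rho>) \<le> ereal 0"
      by (intro INF_lower) (auto simp: zero_ereal_def[symmetric])
    then have "ereal (1 / t) *
        (INF \<rho>\<in>{\<rho>::real. \<phi> (x + t *\<^sub>R u) \<le> \<phi> x + ereal \<rho>}. ereal \<rho>) \<le> ereal (1 / t) * ereal 0"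
      using t by (intro ereal_mult_left_mono) auto
    with pos[OF t] show False by (simp add: zero_ereal_def[symmetric])
  qed
  with e that show thesis by blast
qed

text \<open>
  A step from \<open>t\<close> towards \<open>0\<close> that covers the fraction \<open>h < 1\<close> of the way stays in \<open>[0,1]\<close>,
  where the restriction to the segment agrees with \<open>\<phi>\<close>. Only such \<open>h\<close> matter for the limit
  inferior.
\<close>

lemma lower_dini_radial_restriction:
  fixes x x0 :: "'a::real_vector"
  assumes t: "0 \<le> t" "t \<le> 1"
  defines "y \<equiv> x0 + t *\<^sub>R (x - x0)"
  shows "lower_dini (radial_restriction \<phi> x0 x) t (0 - t) = lower_dini \<phi> y (x0 - y)"
  unfolding lower_dini_def
proof (rule Liminf_eq)
  have "\<forall>\<^sub>F h in at_right 0. h \<in> {0<..<1::real}"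
    by (rule eventually_at_right_real) simp
  then show "\<forall>\<^sub>F h in at_right 0.
    ereal (1 / h) * (INF \<rho>\<in>{\<rho>::real. radial_restriction \<phi> x0 x (t + h *\<^sub>R (0 - t))
      \<le> radial_restriction \<phi> x0 x t + ereal \<rho>}. ereal \<rho>) =
    ereal (1 / h) * (INF \<rho>\<in>{\<rho>::real. \<phi> (y + h *\<^sub>R (x0 - y)) \<le> \<phi> y + ereal \<rho>}. ereal \<rho>)"
  proof eventually_elim
    case (elim h)
    have "h * t \<le> t" using elim t by (simp add: mult_left_le_one_le)
    moreover have "0 \<le> h * t" using elim t by simp
    ultimately have "radial_restriction \<phi> x0 x (t + h *\<^sub>R (0 - t)) =
        \<phi> (x0 + (t - h * t) *\<^sub>R (x - x0))"
      using t by (simp add: radial_restriction_def)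
    also have "x0 + (t - h * t) *\<^sub>R (x - x0) = y + h *\<^sub>R (x0 - y)"
      by (simp add: y_def algebra_simps)
    finally show ?case using t by (simp add: radial_restriction_def y_def)
  qed
qed

section \<open>Positivity of the Dini derivative for convex and for pseudolinear functions\<close>

text \<open>
  The point \<open>b\<close> lies between \<open>a\<close> and \<open>b + h (b - a)\<close>, so convexity forces growth beyond \<open>b\<close> at
  least with the slope from \<open>a\<close> to \<open>b\<close>. The factor \<open>k\<close> allows arbitrary speeds along the ray.
\<close>

lemma convex_lower_dini_pos:
  assumes conv: "ereal_convex \<phi>" and \<alpha>: "\<phi> a = ereal \<alpha>" and \<beta>: "\<phi> b = ereal \<beta>"
    and "\<alpha> < \<beta>" and "k > 0"
  shows "lower_dini \<phi> b (k *\<^sub>R (b - a)) > 0"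
proof -
  have growth: "ereal (\<beta> + t * (k * (\<beta> - \<alpha>))) \<le> \<phi> (b + t *\<^sub>R (k *\<^sub>R (b - a)))"
    if "0 < t" for t
  proof (rule ereal_le_real)
    define h where "h = t * k"
    have h: "h > 0" using that \<open>k > 0\<close> by (simp add: h_def)
    let ?p = "b + h *\<^sub>R (b - a)"
    fix z assume "\<phi> (b + t *\<^sub>R (k *\<^sub>R (b - a))) \<le> ereal z"
    then have "(?p, z) \<in> {(x, r::real). \<phi> x \<le> ereal r}" by (simp add: h_def)
    moreover have "(a, \<alpha>) \<in> {(x, r::real). \<phi> x \<le> ereal r}" by (simp add: \<alpha>)
    moreover have "1 / (1 + h) + h / (1 + h) = 1"
      using h by (simp add: add_divide_distrib[symmetric])
    ultimately have
      "(1 / (1 + h)) *\<^sub>R (?p, z) + (h / (1 + h)) *\<^sub>R (a, \<alpha>) \<in> {(x, r::real). \<phi> x \<le> ereal r}"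
      using conv h unfolding ereal_convex_def by (intro convexD) auto
    moreover have "(1 / (1 + h)) *\<^sub>R ?p + (h / (1 + h)) *\<^sub>R a = b"
    proof -
      have "(1 / (1 + h)) *\<^sub>R ?p + (h / (1 + h)) *\<^sub>R a = (1 / (1 + h)) *\<^sub>R ((1 + h) *\<^sub>R b)"
        by (simp add: algebra_simps)
      then show ?thesis using h by simp
    qed
    ultimately have "\<beta> \<le> z / (1 + h) + h * \<alpha> / (1 + h)" by (simp add: \<beta>)
    then have "\<beta> \<le> (z + h * \<alpha>) / (1 + h)" by (simp add: add_divide_distrib)
    then have "\<beta> * (1 + h) \<le> z + h * \<alpha>" using h by (simp add: pos_le_divide_eq)
    then have "\<beta> + h * (\<beta> - \<alpha>) \<le> z" by (simp add: algebra_simps)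
    then show "ereal (\<beta> + t * (k * (\<beta> - \<alpha>))) \<le> ereal z" by (simp add: h_def mult.assoc)
  qed
  have "0 < ereal (k * (\<beta> - \<alpha>))" using assms by simp
  also have "\<dots> \<le> lower_dini \<phi> b (k *\<^sub>R (b - a))"
    by (rule lower_dini_ge[where \<phi> = \<phi> and x = b and e = 1, OF \<beta>]) (use growth in auto)
  finally show ?thesis .
qed

text \<open>
  A smaller value at \<open>b + u\<close> means descent at arbitrarily small steps along the ray, a larger
  value at \<open>b + k u\<close> means ascent at all small steps along the same ray.
\<close>

lemma pseudolinear_ray_values:
  assumes cvx: "pseudoconvex \<phi>" and ccv: "pseudoconcave \<phi>" and fin: "\<bar>\<phi> b\<bar> \<noteq> \<infinity>"
    and "k > 0" and less: "\<phi> (b + u) < \<phi> b"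
    and dom: "b + k *\<^sub>R u \<in> effective_dom \<phi>"
  shows "\<phi> (b + k *\<^sub>R u) \<le> \<phi> b"
proof (rule ccontr)
  assume "\<not> \<phi> (b + k *\<^sub>R u) \<le> \<phi> b"
  moreover have b: "b \<in> effective_dom \<phi>" using fin by (auto simp: effective_dom_def)
  ultimately have "lower_dini \<phi> b (k *\<^sub>R u) > 0"
    using ccv dom unfolding pseudoconcave_def by (metis add_diff_cancel_left' not_le)
  then obtain e where e: "e > 0"
    and up: "\<And>t. 0 < t \<Longrightarrow> t < e \<Longrightarrow> \<phi> b < \<phi> (b + t *\<^sub>R (k *\<^sub>R u))"
    by (rule lower_dini_pos_imp_ascent) blast
  have "b + u \<in> effective_dom \<phi>" using less by (auto simp: effective_dom_def)
  then have "lower_dini \<phi> b u < 0"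
    using cvx less b unfolding pseudoconvex_def by (metis add_diff_cancel_left')
  then obtain t where "0 < t" "t < e * k" "\<phi> (b + t *\<^sub>R u) < \<phi> b"
    using fin e \<open>k > 0\<close> by (auto elim: lower_dini_neg_imp_descent[where e = "e * k"])
  with up[of "t / k"] \<open>k > 0\<close> show False by (simp add: field_simps)
qed

text \<open>
  Pseudoconcavity settles the case \<open>g t < g 0\<close>, so the other cases must be excluded. Seen from
  \<open>0\<close>, the value at \<open>t\<close> cannot be larger while the value at \<open>1\<close> is smaller. If \<open>g t = g 0\<close>,
  descent from \<open>0\<close> yields \<open>s \<in> (0,t)\<close> with \<open>g s < g t\<close>, and seen from \<open>s\<close> the value at \<open>t\<close> is
  larger while the value at \<open>1\<close> is smaller.
\<close>

lemma pseudolinear_lower_dini_pos: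
  fixes g :: "real \<Rightarrow> ereal"
  assumes cvx: "pseudoconvex g" and ccv: "pseudoconcave g"
    and t: "0 < t" "t < 1"
    and fin: "\<And>s. 0 \<le> s \<Longrightarrow> s \<le> 1 \<Longrightarrow> \<bar>g s\<bar> \<noteq> \<infinity>"
    and above: "\<And>s. 0 \<le> s \<Longrightarrow> s \<le> t \<Longrightarrow> g 1 < g s"
  shows "lower_dini g t (0 - t) > 0"
proof -
  have dom: "s \<in> effective_dom g" if "0 \<le> s" "s \<le> 1" for s
    using fin[OF that] by (auto simp: effective_dom_def)
  have le: "g t \<le> g s" if "0 \<le> s" "s < t" for s
    using pseudolinear_ray_values[OF cvx ccv, of s "(t - s) / (1 - s)" "1 - s"]
      that t fin above[of s] dom[of t] by auto
  have "g t \<noteq> g 0"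
  proof
    assume eq: "g t = g 0"
    have "g 1 < g 0" using above[of 0] t by simp
    then have "lower_dini g 0 (1 - 0) < 0"
      using cvx dom[of 0] dom[of 1] unfolding pseudoconvex_def
      by (metis order_refl zero_le_one)
    then obtain s where "0 < s" "s < t" "g s < g 0"
      using fin[of 0] t by (auto elim: lower_dini_neg_imp_descent[where e = t])
    with le[of s] eq show False by simp
  qed
  with le[of 0] t have "g t < g 0" by simp
  then show ?thesis
    using ccv dom[of 0] dom[of t] t unfolding pseudoconcave_def
    by (metis less_imp_le order_refl zero_le_one)
qed

section \<open>The dual cone and the interior of the cone\<close>

text \<open>
  From an interior point of \<open>C\<close> one can move a little in every direction within \<open>C\<close>, in
  particular against a direction in which the functional increases.
\<close>

lemma dual_cone_pos_on_interior:
  fixes C :: "'y::locally_convex_t2_space set"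
  assumes w: "w \<in> dual_cone C" and "w \<noteq> (\<lambda>y. 0)" and c: "c \<in> interior C"
  shows "w c > 0"
proof -
  have lin: "linear w" using w by (auto simp: dual_cone_def top_dual_def)
  obtain y0 where "w y0 \<noteq> 0" using assms(2) by auto
  then obtain y where y: "w y > 0"
    by (metis lin linear_neg neg_0_less_iff_less not_less_iff_gr_or_eq)
  have "((\<lambda>e. e *\<^sub>R y) \<longlongrightarrow> 0 *\<^sub>R y) (at_right 0)"
    using filterlim_compose[OF tendsto_scaleR_Pair[of 0 y],
        of "\<lambda>e. (e, y)" "at_right 0"]
    by (simp add: filterlim_Pair)
  then have "((\<lambda>e. c - e *\<^sub>R y) \<longlongrightarrow> c) (at_right 0)"
    using tendsto_diff[OF tendsto_const, of "\<lambda>e. e *\<^sub>R y" "0 *\<^sub>R y" "at_right 0" c] by simp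
  then have "\<forall>\<^sub>F e in at_right 0. c - e *\<^sub>R y \<in> interior C"
    using c by (auto dest: topological_tendstoD[where S = "interior C"])
  moreover have "\<forall>\<^sub>F e in at_right 0. (0::real) < e" by (rule eventually_at_right_less)
  ultimately have "\<forall>\<^sub>F e in at_right 0. 0 < e \<and> c - e *\<^sub>R y \<in> interior C"
    by eventually_elim auto
  then obtain e where e: "0 < e" "c - e *\<^sub>R y \<in> C"
    using eventually_happens[of _ "at_right (0::real)"] interior_subset[of C] by auto
  then have "0 \<le> w (c - e *\<^sub>R y)" using w by (auto simp: dual_cone_def)
  then have "e * w y \<le> w c" by (simp add: linear_diff[OF lin] linear_cmul[OF lin])
  with y e show ?thesis by (smt (verit) mult_pos_pos)
qed

lemma weak_star_compact_base_dual_coneD: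
  assumes "weak_star_compact_base (dual_cone C) W" and "w \<in> W"
  shows "w \<in> dual_cone C" and "w \<noteq> (\<lambda>y. 0)"
proof -
  have "dual_cone C = {(\<lambda>y. t * f y) | t f. 0 \<le> t \<and> f \<in> W}"
    using assms(1) by (simp add: weak_star_compact_base_def)
  moreover have "w = (\<lambda>y. 1 * w y)" and "(0::real) \<le> 1" by simp_all
  ultimately show "w \<in> dual_cone C" using \<open>w \<in> W\<close> by blast
  show "w \<noteq> (\<lambda>y. 0)" using assms unfolding weak_star_compact_base_def by blast
qed

text \<open>
  Radial \<open>C\<close>-continuity is used with a \<open>U\<close> such that \<open>c + U \<subseteq> int C\<close>, where
  \<open>c = F x0 - F x\<close>. This choice involves no functional, which makes the bound on \<open>t\<close> uniform.
\<close>

lemma scalar_values_near_start_uniformly_above: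
  fixes F :: "'x::real_vector \<Rightarrow> 'y::locally_convex_t2_space"
  assumes base: "bco_zero_nbhd_base \<U>" and cont: "radially_C_continuous \<U> C S F x0"
    and "x \<in> S" and c: "F x0 - F x \<in> interior C"
  obtains t0 where "0 < t0" "t0 < 1"
    "\<And>w t. w \<in> dual_cone C \<Longrightarrow> w \<noteq> (\<lambda>y. 0) \<Longrightarrow> 0 \<le> t \<Longrightarrow> t < t0 \<Longrightarrow>
      w (F x) < w (F (x0 + t *\<^sub>R (x - x0)))"
proof -
  let ?c = "F x0 - F x"
  let ?V = "(\<lambda>u. ?c + u) -` interior C"
  have "open ?V" by (intro open_vimage open_interior continuous_intros)
  moreover have "0 \<in> ?V" using c by simp
  ultimately obtain U where U: "U \<in> \<U>" "U \<subseteq> ?V"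
    using base unfolding bco_zero_nbhd_base_def by blast
  obtain t0 where t0: "0 < t0" "t0 < 1"
    and near: "\<forall>t\<in>{0<..<t0}.
      F (x0 + t *\<^sub>R (x - x0)) \<in> {F x0 + c + u | c u. c \<in> C \<and> u \<in> U}"
    using cont \<open>x \<in> S\<close> U(1) unfolding radially_C_continuous_def by fastforce
  have "w (F x) < w (F (x0 + t *\<^sub>R (x - x0)))"
    if w: "w \<in> dual_cone C" "w \<noteq> (\<lambda>y. 0)" and t: "0 \<le> t" "t < t0" for w t
  proof -
    have lin: "linear w" using w by (auto simp: dual_cone_def top_dual_def)
    show ?thesis
    proof (cases "t = 0")
      case True
      then show ?thesis
        using dual_cone_pos_on_interior[OF w c] by (simp add: linear_diff[OF lin])
    next
      case False
      with near t obtain d u where du: "d \<in> C" "u \<in> U"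
        and eq: "F (x0 + t *\<^sub>R (x - x0)) = F x0 + d + u" by fastforce
      have "0 < w (?c + u)" using U(2) du(2) by (intro dual_cone_pos_on_interior[OF w]) auto
      moreover have "0 \<le> w d" using w(1) du(1) by (simp add: dual_cone_def)
      ultimately show ?thesis
        by (simp add: eq linear_diff[OF lin] linear_add[OF lin])
    qed
  qed
  with t0 that show thesis by blast
qed

section \<open>Weak efficiency\<close>

theorem corollary3p4:
  fixes S :: "'x::locally_convex_t2_space set"
    and x0 :: 'x
    and F :: "'x \<Rightarrow> 'y::locally_convex_t2_space"
    and C :: "'y set"
    and \<U> :: "'y set set"
    and W :: "('y \<Rightarrow> real) set"
  assumes "bco_zero_nbhd_base \<U>"
    and "closed C" and "convex_cone C" and "interior C \<noteq> {}" and "C \<noteq> UNIV"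
    and "weak_star_compact_base (dual_cone C) W"
    and "x0 \<in> S" and "star_shaped_at S x0"
    and "radially_C_continuous \<U> C S F x0"
    and "\<forall>w\<in>W.
      (radially_pseudoconvex (scalarization S F w) x0 \<and>
       radially_pseudoconcave (scalarization S F w) x0) \<or>
      radially_convex (scalarization S F w) x0"
    and "\<forall>x. \<exists>w\<in>W. lower_dini (scalarization S F w) x (x0 - x) \<le> 0"
  shows "weakly_efficient_minimizer C S F x0"
proof (rule ccontr)
  assume "\<not> weakly_efficient_minimizer C S F x0"
  then obtain c x where "c \<in> interior C" and x: "x \<in> S" and "F x = F x0 - c"
    unfolding weakly_efficient_minimizer_def by auto
  then have "F x0 - F x \<in> interior C" by simp
  with assms(1,9) x obtain t0 where t0: "0 < t0" "t0 < 1"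
    and above: "\<And>w t. w \<in> dual_cone C \<Longrightarrow> w \<noteq> (\<lambda>y. 0) \<Longrightarrow> 0 \<le> t \<Longrightarrow> t < t0 \<Longrightarrow>
      w (F x) < w (F (x0 + t *\<^sub>R (x - x0)))"
    by (rule scalar_values_near_start_uniformly_above) blast
  define t where "t = t0 / 2"
  have t: "0 < t" "t < t0" "t < 1" using t0 by (auto simp: t_def)
  define y where "y = x0 + t *\<^sub>R (x - x0)"
  obtain w where w: "w \<in> W" and dini: "lower_dini (scalarization S F w) y (x0 - y) \<le> 0"
    using assms(11) by blast
  define g where "g = radial_restriction (scalarization S F w) x0 x"
  have g: "g s = ereal (w (F (x0 + s *\<^sub>R (x - x0))))" if "0 \<le> s" "s \<le> 1" for s
    using assms(8) x that
    by (auto simp: g_def radial_restriction_def scalarization_def star_shaped_at_def)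
  have g_above: "g 1 < g s" if "0 \<le> s" "s \<le> t" for s
    using above[OF weak_star_compact_base_dual_coneD[OF assms(6) w], of s] that t g[of s] g[of 1]
    by simp
  have "lower_dini g t (0 - t) > 0"
  proof (cases "radially_convex (scalarization S F w) x0")
    case True
    then have "ereal_convex g" by (auto simp: g_def radially_convex_def)
    then have "lower_dini g t ((t / (1 - t)) *\<^sub>R (t - 1)) > 0"
      by (rule convex_lower_dini_pos[where \<alpha> = "w (F x)" and \<beta> = "w (F y)"])
        (use t g[of 1] g[of t] g_above[of t] in \<open>auto simp: y_def\<close>)
    moreover have "(t / (1 - t)) *\<^sub>R (t - 1) = 0 - t"
      using t by (simp add: field_simps)
    ultimately show ?thesis by simp
  next
    case False
    with assms(10) w have "pseudoconvex g" "pseudoconcave g"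
      by (auto simp: g_def radially_pseudoconvex_def radially_pseudoconcave_def)
    then show ?thesis
      using t g g_above by (intro pseudolinear_lower_dini_pos) auto
  qed
  then have "lower_dini (scalarization S F w) y (x0 - y) > 0"
    using t by (simp only: g_def y_def lower_dini_radial_restriction less_imp_le)
  with dini show False by simp
qed

end
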